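(* Let $\{\pi_m\}_{m\ge 0}$ be a sequence of real polynomials, $\deg \pi_m=m$, with leading coefficients $k_m$, orthogonal with respect to a nonnegative integrable weight function $\omega$ on an interval $(a,b)$: $\int_a^b\omega(x)\pi_m(x)\pi_l(x)\,dx=h_m\delta_{ml}$ with $h_m>0$. Suppose there are polynomials $\varphi$ of degree at most $2$ and $\phi$ of degree at most $1$ such that $(\varphi(x)\omega(x))'=\phi(x)\omega(x)$ on $(a,b)$ and such that for every $m\ge 0$ $$\varphi(x)\pi_m''(x)+\phi(x)\pi_m'(x)+\nu_m\pi_m(x)=0,\qquad \nu_m=-m\phi'-\frac{m(m-1)}{2}\varphi''$$ ($\phi'$ and $\varphi''$ are constants). Let $n\ge 0$, let $x_0<x_1<\dots<x_n$ be the roots of $\pi_{n+1}$, let $w_0,\dots,w_n$ be the weights of the $(n+1)$-point Gaussian quadrature rule for $\omega$ on $(a,b)$ with nodes $x_0,\dots,x_n$, and let $\lambda_j=\prod_{k\ne j}(x_j-x_k)^{-1}$ be the barycentric weights of the nodes $x_0,\dots,x_n$. Then $$\lambda_j=\sigma(-1)^j\sqrt{\frac{k_{n+1}^2\,(2n+2)\,\varphi(x_j)\,w_j}{\nu_{2n+2}\,h_{n+1}}},\qquad j=0,1,\dots,n,$$ where $\sigma=+1$ if $n$ is even and $\sigma=-1$ if $n$ is odd.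
   Context: The $(n+1)$-point Gaussian quadrature rule for a weight $\omega$ on $(a,b)$ is the rule $\int_a^b\omega(x)f(x)\,dx\simeq\sum_{j=0}^n w_jf(x_j)$, with nodes the roots of the degree-$(n+1)$ orthogonal polynomial, that is exact for all polynomials $f$ of degree at most $2n+1$.
   Formalization: The polynomials φ (varphi) and ϕ (phi) are assumed not to be both identically zero; if both vanish, every hypothesis holds for any weight, all ν_m are 0 and the formula reads 0/0. *)

theory Defs
  imports "HOL-Analysis.Analysis" "HOL-Computational_Algebra.Polynomial"
begin

text \<open>
  The interval \<open>(a,b)\<close> may be unbounded, so its endpoints are extended reals.
  The integrability conjunct is needed because a divergent integral has the value \<open>0\<close>.
  Since \<open>h 0 > 0\<close>, the condition \<open>degree (\<pi> 0) = 0\<close> does not admit the zero polynomial.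
\<close>

definition orthogonal_polynomials ::
    "ereal \<Rightarrow> ereal \<Rightarrow> (real \<Rightarrow> real) \<Rightarrow> (nat \<Rightarrow> real poly) \<Rightarrow> (nat \<Rightarrow> real) \<Rightarrow> bool" where
  "orthogonal_polynomials a b \<omega> \<pi> h \<longleftrightarrow>
     (\<forall>m. degree (\<pi> m) = m) \<and>
     (\<forall>m. h m > 0) \<and>
     (\<forall>m l. interval_lebesgue_integrable lborel a b (\<lambda>x. \<omega> x * poly (\<pi> m) x * poly (\<pi> l) x) \<and>
            (LBINT x=a..b. \<omega> x * poly (\<pi> m) x * poly (\<pi> l) x) = (if m = l then h m else 0))"

definition gaussian_quadrature ::
    "ereal \<Rightarrow> ereal \<Rightarrow> (real \<Rightarrow> real) \<Rightarrow> (nat \<Rightarrow> real poly) \<Rightarrow> nat \<Rightarrow> (nat \<Rightarrow> real) \<Rightarrow> (nat \<Rightarrow> real) \<Rightarrow> bool" where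
  "gaussian_quadrature a b \<omega> \<pi> n x w \<longleftrightarrow>
     inj_on x {..n} \<and> x ` {..n} = {t. poly (\<pi> (Suc n)) t = 0} \<and>
     (\<forall>f. degree f \<le> 2 * n + 1 \<longrightarrow>
        (LBINT t=a..b. \<omega> t * poly f t) = (\<Sum>j\<le>n. w j * poly f (x j)))"

definition barycentric_weight :: "nat \<Rightarrow> (nat \<Rightarrow> real) \<Rightarrow> nat \<Rightarrow> real" where
  "barycentric_weight n x j = (\<Prod>k\<in>{..n} - {j}. inverse (x j - x k))"

text \<open>
  For \<open>degree varphi \<le> 2\<close> and \<open>degree phi \<le> 1\<close> the derivatives \<open>varphi''\<close> and \<open>phi'\<close> are
  constant; their values are taken at \<open>0\<close>.
\<close>

definition ode_eigenvalue :: "real poly \<Rightarrow> real poly \<Rightarrow> nat \<Rightarrow> real" where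
  "ode_eigenvalue varphi phi m =
     - real m * poly (pderiv phi) 0
     - real m * (real m - 1) / 2 * poly (pderiv (pderiv varphi)) 0"

end

theory Submission
  imports Defs
begin

text \<open>
  Let \<open>L f = \<integral> \<omega> f\<close>. Applying \<open>L\<close> to the differential equation of \<open>\<pi>\<^sub>m\<close> gives
  \<open>L (phi g + varphi g') = 0\<close> for \<open>g = \<pi>\<^sub>m'\<close>, hence for every polynomial \<open>g\<close>, so no
  discussion of boundary values of \<open>varphi \<omega>\<close> is needed. Put \<open>N = n + 1\<close>, \<open>p = \<pi>\<^sub>N\<close>,
  \<open>q = p / (X - x\<^sub>j)\<close>, and let \<open>v\<close> be the coefficient of \<open>X\<^sup>2\<close> in \<open>varphi\<close>. With \<open>g = p q\<close>,
  orthogonality evaluates \<open>L (varphi p' q) = - L (p (phi q + varphi q'))\<close> from leading coefficients.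
  The polynomial \<open>varphi p' q - v N p\<^sup>2\<close> has degree at most \<open>2 n + 1\<close>, and the quadrature rule reduces
  \<open>L\<close> of it to the term \<open>w\<^sub>j varphi (x\<^sub>j) q (x\<^sub>j)\<^sup>2\<close>. As \<open>\<lambda>\<^sub>j = k\<^sub>N / q (x\<^sub>j)\<close>, comparing the two values
  gives \<open>\<lambda>\<^sub>j\<^sup>2\<close>, and the ordering of the nodes gives the sign.
\<close>

section \<open>Polynomials\<close>

lemma coeff_mult_degree_bounds:
  fixes p q :: "'a::comm_semiring_0 poly"
  assumes "degree p \<le> m" "degree q \<le> n"
  shows "coeff (p * q) (m + n) = coeff p m * coeff q n"
proof (cases "degree p = m \<and> degree q = n")
  case True
  then show ?thesis
    using coeff_mult_degree_sum[of p q] by auto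
next
  case False
  with assms have "degree p < m \<or> degree q < n" "degree p + degree q < m + n"
    by auto
  moreover from this have "coeff (p * q) (m + n) = 0"
    by (intro coeff_eq_0 le_less_trans[OF degree_mult_le])
  ultimately show ?thesis
    by (auto simp: coeff_eq_0)
qed

lemma degree_le_if_coeff_Suc_eq_0:
  assumes "degree p \<le> Suc d" "coeff p (Suc d) = 0"
  shows "degree p \<le> d"
proof (rule degree_le, intro allI impI)
  fix i assume "d < i"
  then show "coeff p i = 0"
    using assms by (cases "i = Suc d") (auto intro: coeff_eq_0)
qed

lemma pderiv_surj: "\<exists>f. pderiv f = g" for g :: "'a::field_char_0 poly"
proof
  let ?f = "\<Sum>i\<le>degree g. monom (coeff g i / of_nat (Suc i)) (Suc i)"
  have "pderiv ?f = (\<Sum>i\<le>degree g. monom (coeff g i) i)"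
    by (simp add: higher_pderiv_sum[of 1, simplified] pderiv_monom del: of_nat_Suc)
  then show "pderiv ?f = g"
    by (simp add: poly_as_sum_of_monoms)
qed

text \<open>Subtracting the right multiple of \<open>\<pi> d\<close> cancels the top coefficient, so
  a statement stable under linear combinations need only be checked on the \<open>\<pi> m\<close>.
  The bound \<open>m \<le> d\<close> in \<open>base\<close> is what the expansion in
  \<open>L_\<pi>_mult\<close> relies on.\<close>

lemma degree_graded_span_induct:
  fixes \<pi> :: "nat \<Rightarrow> 'a::field poly"
  assumes deg: "\<And>m. degree (\<pi> m) = m" and nz: "\<pi> 0 \<noteq> 0"
    and "degree f \<le> d"
    and base: "\<And>m. m \<le> d \<Longrightarrow> P (\<pi> m)"
    and add: "\<And>f g. P f \<Longrightarrow> P g \<Longrightarrow> P (f + g)"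
    and smult: "\<And>c f. P f \<Longrightarrow> P (smult c f)"
  shows "P f"
  using \<open>degree f \<le> d\<close> base
proof (induction d arbitrary: f)
  case 0
  obtain c where "f = [:c:]"
    using 0 by (metis degree_eq_zeroE le_zero_eq)
  moreover obtain e where "\<pi> 0 = [:e:]" "e \<noteq> 0"
    using deg[of 0] nz by (metis degree_eq_zeroE pCons_0_0)
  ultimately have "f = smult (c / e) (\<pi> 0)"
    by simp
  then show ?case
    using 0 smult by auto
next
  case (Suc d)
  define c where "c = coeff f (Suc d) / lead_coeff (\<pi> (Suc d))"
  have "\<pi> (Suc d) \<noteq> 0"
    using deg[of "Suc d"] by auto
  then have "lead_coeff (\<pi> (Suc d)) \<noteq> 0"
    by (simp only: leading_coeff_0_iff not_False_eq_True)
  then have "coeff (f - smult c (\<pi> (Suc d))) (Suc d) = 0"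
    by (simp add: c_def deg)
  moreover have "degree (f - smult c (\<pi> (Suc d))) \<le> Suc d"
    using Suc.prems deg by (intro degree_diff_le) (auto intro: order_trans[OF degree_smult_le])
  ultimately have "degree (f - smult c (\<pi> (Suc d))) \<le> d"
    by (rule degree_le_if_coeff_Suc_eq_0[rotated])
  then have "P (f - smult c (\<pi> (Suc d)))"
    using Suc.IH Suc.prems by simp
  from add[OF this smult[OF Suc.prems(2)]] show ?case
    by (metis diff_add_cancel order_refl)
qed

lemma poly_eq_smult_prod_roots:
  fixes p :: "'a::idom poly"
  assumes "finite A" "degree p = card A" "\<And>t. t \<in> A \<Longrightarrow> poly p t = 0"
  shows "p = smult (lead_coeff p) (\<Prod>t\<in>A. [:- t, 1:])"
proof (rule poly_eqI_degree_lead_coeff[where A = A and n = "card A"])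
  have deg: "degree (\<Prod>t\<in>A. [:- t, 1:]) = card A"
    by (subst degree_prod_eq_sum_degree) auto
  then have "coeff (\<Prod>t\<in>A. [:- t, 1:]) (card A) = 1"
    by (metis (no_types, lifting) lead_coeff_prod lead_coeff_pCons(1) one_neq_zero prod.neutral
        pCons_eq_0_iff lead_coeff_1 one_pCons)
  then show "coeff p (card A) = coeff (smult (lead_coeff p) (\<Prod>t\<in>A. [:- t, 1:])) (card A)"
    using assms by simp
  show "degree (smult (lead_coeff p) (\<Prod>t\<in>A. [:- t, 1:])) \<le> card A"
    using deg degree_smult_le by metis
qed (use assms in \<open>auto simp: poly_prod\<close>)


section \<open>Functionals with a classical orthogonal system\<close>

text \<open>Separates the algebra from the integral: linearity and the orthogonality relations are
  all that is kept of the weight.\<close>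

locale orthogonal_functional =
  fixes L :: "real poly \<Rightarrow> real" and \<pi> :: "nat \<Rightarrow> real poly" and h :: "nat \<Rightarrow> real"
  assumes L_add: "L (f + g) = L f + L g"
    and L_smult: "L (smult c f) = c * L f"
    and degree_\<pi>: "degree (\<pi> m) = m"
    and h_pos: "h m > 0"
    and orthogonal: "L (\<pi> m * \<pi> l) = (if m = l then h m else 0)"
begin

lemma L_0 [simp]: "L 0 = 0"
  using L_smult[of 0 0] by simp

lemma L_minus: "L (- f) = - L f"
  using L_smult[of "-1" f] by simp

lemma L_diff: "L (f - g) = L f - L g"
  using L_add[of f "- g"] by (simp add: L_minus)

lemma \<pi>_nonzero: "\<pi> m \<noteq> 0"
  using orthogonal[of m m] h_pos[of m] by auto

lemma coeff_\<pi>_nonzero: "coeff (\<pi> m) m \<noteq> 0"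
  using \<pi>_nonzero[of m] degree_\<pi>[of m] by (metis leading_coeff_0_iff)

lemmas span_induct = degree_graded_span_induct[of \<pi>, OF degree_\<pi> \<pi>_nonzero]

text \<open>In the expansion of \<open>g\<close> in \<open>\<pi> 0\<close>, ...,
  \<open>\<pi> d\<close> only the last term survives, and its coefficient is the ratio of the
  coefficients of degree \<open>d\<close>. If \<open>degree g < d\<close>, both sides
  vanish.\<close>

lemma L_\<pi>_mult:
  assumes "degree g \<le> d"
  shows "L (\<pi> d * g) = coeff g d / coeff (\<pi> d) d * h d"
  using assms
proof (rule span_induct)
  fix m assume "m \<le> d"
  then show "L (\<pi> d * \<pi> m) = coeff (\<pi> m) d / coeff (\<pi> d) d * h d"
    using degree_\<pi>[of m] coeff_\<pi>_nonzero[of d] by (auto simp: orthogonal coeff_eq_0)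
qed (auto simp: L_add L_smult distrib_left distrib_right add_divide_distrib)

text \<open>Testing against \<open>\<pi> (degree f)\<close> isolates the leading coefficient of
  \<open>f\<close>, multiplied by a nonzero factor.\<close>

lemma nondegenerate:
  assumes "\<And>g. L (f * g) = 0"
  shows "f = 0"
proof -
  have "lead_coeff f / coeff (\<pi> (degree f)) (degree f) * h (degree f) = 0"
    using assms[of "\<pi> (degree f)"] L_\<pi>_mult[of f "degree f"] by (simp add: mult.commute)
  then show ?thesis
    using h_pos[of "degree f"] coeff_\<pi>_nonzero[of "degree f"] by auto
qed

lemma L_\<pi>_eq_0: "m > 0 \<Longrightarrow> L (\<pi> m) = 0"
  using L_\<pi>_mult[of 1 m] by simp

end

text \<open>For \<open>varphi = phi = 0\<close> every eigenvalue is 0 and \<open>ode\<close> holds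
  trivially; \<open>nontrivial\<close> excludes this case, in which the final quotient would have
  denominator 0.\<close>

locale classical_functional = orthogonal_functional +
  fixes varphi phi :: "real poly"
  assumes degree_varphi: "degree varphi \<le> 2" and degree_phi: "degree phi \<le> 1"
    and nontrivial: "varphi \<noteq> 0 \<or> phi \<noteq> 0"
    and ode: "varphi * pderiv (pderiv (\<pi> m)) + phi * pderiv (\<pi> m)
               + smult (ode_eigenvalue varphi phi m) (\<pi> m) = 0"
begin

lemma pearson: "L (phi * g + varphi * pderiv g) = 0"
proof -
  \<comment> \<open>With \<open>g = f'\<close> the claim is linear in \<open>f\<close>, so it
    suffices to take \<open>f = \<pi> m\<close>, where \<open>ode\<close> applies.\<close>
  obtain f where g: "g = pderiv f"
    using pderiv_surj by metis
  show ?thesis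
    unfolding g
  proof (rule span_induct[where f = f, OF order_refl])
    fix m
    have "phi * pderiv (\<pi> m) + varphi * pderiv (pderiv (\<pi> m))
            = - smult (ode_eigenvalue varphi phi m) (\<pi> m)"
      using ode[of m] by (simp add: eq_neg_iff_add_eq_0 add_ac)
    \<comment> \<open>For \<open>m = 0\<close> the eigenvalue is 0; for \<open>m > 0\<close> the
      value \<open>L (\<pi> m)\<close> is 0.\<close>
    then show "L (phi * pderiv (\<pi> m) + varphi * pderiv (pderiv (\<pi> m))) = 0"
      using L_\<pi>_eq_0[of m] by (cases "m = 0") (auto simp: L_minus L_smult ode_eigenvalue_def)
  next
    fix f g :: "real poly" and c
    assume "L (phi * pderiv f + varphi * pderiv (pderiv f)) = 0"
    then show "L (phi * pderiv (smult c f) + varphi * pderiv (pderiv (smult c f))) = 0"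
      by (metis L_smult mult_smult_right mult_zero_right pderiv_smult smult_add_right)
    assume "L (phi * pderiv g + varphi * pderiv (pderiv g)) = 0"
    with \<open>L (phi * pderiv f + varphi * pderiv (pderiv f)) = 0\<close>
    show "L (phi * pderiv (f + g) + varphi * pderiv (pderiv (f + g))) = 0"
      by (simp add: pderiv_add distrib_left L_add)
  qed
qed

text \<open>Permits the division by the eigenvalue. If it were 0, then
  \<open>r = \<pi>\<^sub>m'\<close> would satisfy \<open>varphi r' + phi r = 0\<close>, and
  \<open>pearson\<close> for \<open>f r\<close> would leave \<open>L (varphi r f') = 0\<close> for
  all \<open>f\<close>. Nondegeneracy then forces \<open>varphi = 0\<close>, and
  \<open>pearson\<close> in turn \<open>phi = 0\<close>.\<close>

lemma ode_eigenvalue_nonzero: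
  assumes "m > 0"
  shows "ode_eigenvalue varphi phi m \<noteq> 0"
proof
  assume 0: "ode_eigenvalue varphi phi m = 0"
  define r where "r = pderiv (\<pi> m)"
  have r: "varphi * pderiv r + phi * r = 0"
    using ode[of m] 0 by (simp add: r_def)
  have "r \<noteq> 0"
    using assms degree_\<pi>[of m] by (simp add: r_def pderiv_eq_0_iff)
  have "L (varphi * r * g) = 0" for g
  proof -
    obtain f where g: "g = pderiv f"
      using pderiv_surj by metis
    have "phi * (f * r) + varphi * pderiv (f * r)
            = varphi * r * g + f * (varphi * pderiv r + phi * r)"
      by (simp add: g pderiv_mult algebra_simps)
    then show ?thesis
      using pearson[of "f * r"] r by simp
  qed
  then have "varphi * r = 0"
    by (rule nondegenerate)
  with \<open>r \<noteq> 0\<close> have "varphi = 0"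
    by simp
  moreover from this have "phi = 0"
    using pearson by (intro nondegenerate) simp
  ultimately show False
    using nontrivial by simp
qed

lemma ode_eigenvalue_double:
  "ode_eigenvalue varphi phi (2 * m) =
     - (2 * real m) * (coeff phi 1 + (2 * real m - 1) * coeff varphi 2)"
proof -
  have "poly (pderiv phi) 0 = coeff phi 1"
    "poly (pderiv (pderiv varphi)) 0 = 2 * coeff varphi 2"
    by (simp_all add: poly_0_coeff_0 coeff_pderiv numeral_2_eq_2)
  then show ?thesis
    by (simp add: ode_eigenvalue_def field_simps)
qed

lemma gauss_weight_identity:
  assumes p: "\<pi> (Suc n) = [:- x j, 1:] * q"
    and "j \<le> n"
    and roots: "\<And>i. i \<le> n \<Longrightarrow> poly (\<pi> (Suc n)) (x i) = 0"
    and q_roots: "\<And>i. i \<le> n \<Longrightarrow> i \<noteq> j \<Longrightarrow> poly q (x i) = 0"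
    and quad: "\<And>f. degree f \<le> 2 * n + 1 \<Longrightarrow> L f = (\<Sum>i\<le>n. w i * poly f (x i))"
  shows "(2 * real n + 2) * (w j * poly varphi (x j) * (poly q (x j))\<^sup>2)
           = ode_eigenvalue varphi phi (2 * n + 2) * h (Suc n)"
proof -
  define p where "p = \<pi> (Suc n)"
  define k where "k = coeff p (Suc n)"
  define v where "v = coeff varphi 2"
  define f where "f = varphi * pderiv p * q"
  \<comment> \<open>The degree of \<open>f\<close> may be \<open>2 n + 2\<close>, one too many for
    the quadrature rule. The subtracted multiple of \<open>p * p\<close> has the same coefficient
    there, vanishes at all nodes, and has a value under \<open>L\<close> known from
    \<open>h\<close>.\<close>
  define R where "R = f - smult (v * real (Suc n)) (p * p)"
  have degp: "degree p = Suc n"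
    by (simp add: p_def degree_\<pi>)
  have "k \<noteq> 0"
    by (simp add: k_def p_def coeff_\<pi>_nonzero)
  have "q \<noteq> 0"
    using degp p by (auto simp: p_def)
  then have degq: "degree q = n"
    using degp p by (simp add: p_def degree_mult_eq del: mult_pCons_left)
  have k_q: "coeff q n = k"
    using p degq by (simp add: k_def p_def coeff_eq_0)
  have degp': "degree (pderiv p) = n"
    by (simp add: degree_pderiv degp)
  have k_p': "coeff (pderiv p) n = real (Suc n) * k"
    by (simp add: coeff_pderiv k_def)

  have deg_g: "degree (phi * q + varphi * pderiv q) \<le> Suc n"
  proof (rule degree_add_le)
    show "degree (phi * q) \<le> Suc n"
      using degree_mult_le[of phi q] degree_phi degq by linarith
    show "degree (varphi * pderiv q) \<le> Suc n"
    \<comment> \<open>For \<open>n = 0\<close> the degree of \<open>q'\<close> is not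
      \<open>n - 1\<close> as an integer; \<open>q\<close> is constant and
      \<open>q' = 0\<close>.\<close>
    proof (cases "n = 0")
      case True
      then show ?thesis
        using degq pderiv_eq_0_iff[of q] by simp
    next
      case False
      then show ?thesis
        using degree_mult_le[of varphi "pderiv q"] degree_varphi degq degree_pderiv[of q] by linarith
    qed
  qed
  have phi_q: "coeff (phi * q) (Suc n) = coeff phi 1 * k"
    using coeff_mult_degree_bounds[of phi 1 q n] degree_phi degq k_q by simp
  have varphi_q': "coeff (varphi * pderiv q) (Suc n) = v * real n * k"
  proof (cases n)
    case 0
    then show ?thesis
      using degq pderiv_eq_0_iff[of q] by simp
  next
    case (Suc l)
    then show ?thesis
      using coeff_mult_degree_bounds[of varphi 2 "pderiv q" l] degree_varphi degq
        degree_pderiv[of q] k_q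
      by (simp add: coeff_pderiv v_def numeral_2_eq_2)
  qed
  \<comment> \<open>The cofactor of \<open>p\<close> on the right has degree at most
    \<open>n + 1\<close>, so \<open>L_\<pi>_mult\<close> evaluates that term.\<close>
  have "phi * (p * q) + varphi * pderiv (p * q) = f + p * (phi * q + varphi * pderiv q)"
    by (simp add: f_def pderiv_mult algebra_simps)
  then have "L f = - L (p * (phi * q + varphi * pderiv q))"
    using pearson[of "p * q"] by (simp add: L_add)
  also have "\<dots> = - (coeff phi 1 + v * real n) * h (Suc n)"
  proof -
    have "coeff (phi * q + varphi * pderiv q) (Suc n) = (coeff phi 1 + v * real n) * k"
      by (simp only: coeff_add phi_q varphi_q' distrib_right)
    then have "L (p * (phi * q + varphi * pderiv q)) = (coeff phi 1 + v * real n) * h (Suc n)"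
      using L_\<pi>_mult[OF deg_g] \<open>k \<noteq> 0\<close> unfolding p_def[symmetric] k_def[symmetric] by simp
    then show ?thesis
      by (simp only: minus_mult_left)
  qed
  finally have Lf: "L f = - (coeff phi 1 + v * real n) * h (Suc n)" .

  have "degree f \<le> 2 + n + n"
    unfolding f_def using degree_mult_le[of "varphi * pderiv p" q] degree_mult_le[of varphi "pderiv p"]
      degree_varphi degp' degq by linarith
  moreover have "degree (p * p) \<le> 2 + n + n"
    using degree_mult_le[of p p] degp by simp
  ultimately have degR: "degree R \<le> 2 + n + n"
    unfolding R_def by (intro degree_diff_le) (auto intro: order_trans[OF degree_smult_le])
  have "degree (varphi * pderiv p) \<le> 2 + n"
    using degree_mult_le[of varphi "pderiv p"] degree_varphi degp' by linarith
  then have "coeff f (2 + n + n) = v * (real (Suc n) * k) * k"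
    unfolding f_def
    by (subst coeff_mult_degree_bounds)
       (use degree_varphi degp' degq k_q k_p' in \<open>simp_all add: coeff_mult_degree_bounds v_def del: of_nat_Suc add_2_eq_Suc\<close>)
  moreover have "coeff (p * p) (2 + n + n) = k * k"
    using coeff_mult_degree_bounds[of p "Suc n" p "Suc n"] degp by (simp add: k_def)
  ultimately have "coeff R (2 + n + n) = 0"
    unfolding R_def by (simp del: add_2_eq_Suc)
  with degR have "degree R \<le> Suc (2 * n + 1)" "coeff R (Suc (2 * n + 1)) = 0"
    by (simp_all add: mult_2)
  then have "degree R \<le> 2 * n + 1"
    by (rule degree_le_if_coeff_Suc_eq_0)
  then have "L R = (\<Sum>i\<le>n. w i * poly R (x i))"
    by (rule quad)
  \<comment> \<open>Both \<open>p\<close> and \<open>q\<close> vanish at every node other than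
    \<open>x j\<close>.\<close>
  also have "\<dots> = (\<Sum>i\<in>{j}. w i * poly R (x i))"
    by (rule sum.mono_neutral_right)
       (use \<open>j \<le> n\<close> roots q_roots in \<open>auto simp: R_def f_def p_def\<close>)
  also have "\<dots> = w j * poly varphi (x j) * (poly q (x j))\<^sup>2"
  proof -
    have "poly (pderiv p) (x j) = poly q (x j)"
      unfolding p_def p pderiv_mult by (simp add: pderiv_pCons)
    then show ?thesis
      using roots[OF \<open>j \<le> n\<close>] by (simp add: R_def f_def p_def power2_eq_square)
  qed
  \<comment> \<open>The contributions \<open>v n\<close> from \<open>L f\<close> and
    \<open>v (n + 1)\<close> from \<open>p * p\<close> add up to \<open>v (2 n + 1)\<close>; this is
    how the eigenvalue of index \<open>2 n + 2\<close> arises.\<close>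
  finally have weight: "w j * poly varphi (x j) * (poly q (x j))\<^sup>2
      = - (coeff phi 1 + v * (2 * real n + 1)) * h (Suc n)"
    unfolding R_def L_diff L_smult Lf by (simp add: p_def orthogonal algebra_simps)
  have "ode_eigenvalue varphi phi (2 * n + 2)
      = (2 * real n + 2) * - (coeff phi 1 + v * (2 * real n + 1))"
    using ode_eigenvalue_double[of "Suc n"] by (simp add: v_def algebra_simps)
  then show ?thesis
    unfolding weight by (simp only: mult.assoc)
qed

end


section \<open>The weight function and the barycentric weights\<close>

text \<open>Additivity of the integral requires integrability of \<open>\<omega> f\<close> for every
  polynomial \<open>f\<close>, which is obtained first.\<close>

lemma integral_orthogonal_functional:
  assumes "orthogonal_polynomials a b \<omega> \<pi> h"
  shows "orthogonal_functional (\<lambda>f. LBINT t=a..b. \<omega> t * poly f t) \<pi> h"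
proof -
  let ?I = "\<lambda>f. interval_lebesgue_integrable lborel a b (\<lambda>t. \<omega> t * poly f t)"
  have deg: "\<And>m. degree (\<pi> m) = m" and h: "\<And>m. h m > 0"
    and int: "\<And>m l. interval_lebesgue_integrable lborel a b (\<lambda>t. \<omega> t * poly (\<pi> m) t * poly (\<pi> l) t)"
    and orth: "\<And>m l. (LBINT t=a..b. \<omega> t * poly (\<pi> m) t * poly (\<pi> l) t) = (if m = l then h m else 0)"
    using assms by (auto simp: orthogonal_polynomials_def)
  have "\<pi> 0 \<noteq> 0"
    using orth[of 0 0] h[of 0] by auto
  then obtain e where e: "\<pi> 0 = [:e:]" "e \<noteq> 0"
    using deg[of 0] by (metis degree_eq_zeroE pCons_0_0)
  have integrable: "?I f" for f
  proof (rule degree_graded_span_induct[OF deg \<open>\<pi> 0 \<noteq> 0\<close> order_refl, where P = ?I])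
    fix m
    \<comment> \<open>As \<open>\<pi> 0\<close> is the nonzero constant \<open>e\<close>, the
      orthogonality integrand for \<open>m\<close> and 0 is \<open>e\<close> times
      \<open>\<omega> \<pi>\<^sub>m\<close>.\<close>
    have "interval_lebesgue_integrable lborel a b
            (\<lambda>t. inverse e * (\<omega> t * poly (\<pi> m) t * poly (\<pi> 0) t))"
      using int by (intro interval_lebesgue_integrable_mult_right) auto
    then show "?I (\<pi> m)"
      using e by (simp add: field_simps)
  next
    fix f g assume "?I f" "?I g"
    then show "?I (f + g)"
      by (auto simp: distrib_left)
  next
    fix c f assume "?I f"
    then have "interval_lebesgue_integrable lborel a b (\<lambda>t. c * (\<omega> t * poly f t))"
      by (intro interval_lebesgue_integrable_mult_right)
    then show "?I (smult c f)"
      by (simp add: mult_ac)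
  qed
  show ?thesis
  proof
    fix f g
    show "(LBINT t=a..b. \<omega> t * poly (f + g) t)
            = (LBINT t=a..b. \<omega> t * poly f t) + (LBINT t=a..b. \<omega> t * poly g t)"
      using integrable by (simp add: distrib_left)
  next
    fix c f
    have "(LBINT t=a..b. \<omega> t * poly (smult c f) t) = (LBINT t=a..b. c * (\<omega> t * poly f t))"
      by (simp add: mult_ac)
    then show "(LBINT t=a..b. \<omega> t * poly (smult c f) t) = c * (LBINT t=a..b. \<omega> t * poly f t)"
      by simp
  qed (use deg h orth in \<open>auto simp: mult.assoc\<close>)
qed

lemma sgn_prod: "sgn (prod f A) = (\<Prod>k\<in>A. sgn (f k))" for f :: "'b \<Rightarrow> 'a::linordered_idom"
  by (induction A rule: infinite_finite_induct) (auto simp: sgn_mult)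

text \<open>Exactly the \<open>n - j\<close> factors with \<open>k > j\<close> are negative.\<close>

lemma sgn_barycentric_weight:
  assumes "strict_mono_on {..n} x" "j \<le> n"
  shows "sgn (barycentric_weight n x j) = (-1) ^ (n - j)"
proof -
  have less: "x i < x k" if "i < k" "k \<le> n" for i k
    using strict_mono_onD[OF assms(1), of i k] that by simp
  have split: "{..n} - {j} = {..<j} \<union> {j<..n}" and disjoint: "{..<j} \<inter> {j<..n} = {}"
    using assms(2) by auto
  have "sgn (barycentric_weight n x j)
      = (\<Prod>k<j. sgn (x j - x k)) * (\<Prod>k\<in>{j<..n}. sgn (x j - x k))"
    unfolding barycentric_weight_def sgn_prod sgn_inverse inverse_sgn split
    by (rule prod.union_disjoint) (use disjoint in auto)
  also have "(\<Prod>k<j. sgn (x j - x k)) = 1"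
    using less assms(2) by (intro prod.neutral) auto
  also have "(\<Prod>k\<in>{j<..n}. sgn (x j - x k)) = (\<Prod>k\<in>{j<..n}. -1)"
    using less by (intro prod.cong) auto
  finally show ?thesis
    by simp
qed

theorem theorem2:
  fixes a b :: ereal and \<omega> :: "real \<Rightarrow> real"
    and \<pi> :: "nat \<Rightarrow> real poly" and h :: "nat \<Rightarrow> real"
    and varphi phi :: "real poly"
    and n :: nat and x w :: "nat \<Rightarrow> real"
  assumes "a < b"
    and "\<And>t. t \<in> einterval a b \<Longrightarrow> \<omega> t \<ge> 0"
    and "interval_lebesgue_integrable lborel a b \<omega>"
    and "orthogonal_polynomials a b \<omega> \<pi> h"
    and "degree varphi \<le> 2" and "degree phi \<le> 1"
    and "varphi \<noteq> 0 \<or> phi \<noteq> 0"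
    and "\<And>t. t \<in> einterval a b \<Longrightarrow>
           ((\<lambda>s. poly varphi s * \<omega> s) has_real_derivative poly phi t * \<omega> t) (at t)"
    and "\<And>m. varphi * pderiv (pderiv (\<pi> m)) + phi * pderiv (\<pi> m)
               + smult (ode_eigenvalue varphi phi m) (\<pi> m) = 0"
    and "strict_mono_on {..n} x"
    and "gaussian_quadrature a b \<omega> \<pi> n x w"
  shows "\<forall>j\<le>n. barycentric_weight n x j =
           (if even n then 1 else - 1) * (- 1) ^ j *
           sqrt ((lead_coeff (\<pi> (n + 1)))\<^sup>2 * (2 * real n + 2) * poly varphi (x j) * w j
                 / (ode_eigenvalue varphi phi (2 * n + 2) * h (n + 1)))"
proof (intro allI impI)
  fix j assume j: "j \<le> n"
  let ?L = "\<lambda>f. LBINT t=a..b. \<omega> t * poly f t"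
  let ?\<nu> = "ode_eigenvalue varphi phi (2 * n + 2)"
  interpret orthogonal_functional ?L \<pi> h
    using assms(4) by (rule integral_orthogonal_functional)
  interpret classical_functional ?L \<pi> h varphi phi
    using assms(5-7,9) by unfold_locales
  have inj: "inj_on x {..n}" and img: "x ` {..n} = {t. poly (\<pi> (Suc n)) t = 0}"
    and quad: "\<And>f. degree f \<le> 2 * n + 1 \<Longrightarrow> ?L f = (\<Sum>j\<le>n. w j * poly f (x j))"
    using assms(11) unfolding gaussian_quadrature_def by blast+
  have roots: "poly (\<pi> (Suc n)) (x i) = 0" if "i \<le> n" for i
    using img that by blast
  define k where "k = lead_coeff (\<pi> (n + 1))"
  define q where "q = smult k (\<Prod>i\<in>{..n} - {j}. [:- x i, 1:])"
  have "\<pi> (Suc n) = smult k (\<Prod>t\<in>x ` {..n}. [:- t, 1:])"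
    unfolding k_def Suc_eq_plus1[symmetric]
    by (rule poly_eq_smult_prod_roots) (use roots in \<open>auto simp: card_image[OF inj] degree_\<pi>\<close>)
  also have "(\<Prod>t\<in>x ` {..n}. [:- t, 1:]) = (\<Prod>i\<le>n. [:- x i, 1:])"
    by (simp add: prod.reindex[OF inj])
  also have "\<dots> = [:- x j, 1:] * (\<Prod>i\<in>{..n} - {j}. [:- x i, 1:])"
    using j by (intro prod.remove) auto
  finally have p: "\<pi> (Suc n) = [:- x j, 1:] * q"
    by (simp add: q_def del: mult_pCons_left)
  have "poly q (x i) = 0" if "i \<le> n" "i \<noteq> j" for i
    using that by (auto simp: q_def poly_prod)
  from gauss_weight_identity[OF p j roots this quad]
  have gauss: "(2 * real n + 2) * (w j * poly varphi (x j) * (poly q (x j))\<^sup>2) = ?\<nu> * h (n + 1)"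
    by simp
  have "k \<noteq> 0"
    by (simp add: k_def \<pi>_nonzero)
  have bary: "barycentric_weight n x j = k / poly q (x j)"
  proof -
    have "barycentric_weight n x j = inverse (\<Prod>i\<in>{..n} - {j}. x j - x i)"
      unfolding barycentric_weight_def by (rule prod_inversef[unfolded o_def])
    moreover have "poly q (x j) = k * (\<Prod>i\<in>{..n} - {j}. x j - x i)"
      by (simp add: q_def poly_prod)
    ultimately show ?thesis
      using \<open>k \<noteq> 0\<close> by (simp add: divide_inverse)
  qed
  have "poly q (x j) \<noteq> 0"
    using \<open>k \<noteq> 0\<close> inj j by (auto simp: q_def poly_prod inj_on_eq_iff)
  then have "k\<^sup>2 * (2 * real n + 2) * poly varphi (x j) * w j
      = (barycentric_weight n x j)\<^sup>2 * (?\<nu> * h (n + 1))"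
    unfolding bary gauss[symmetric] by (simp add: power_divide)
  \<comment> \<open>After division the radicand is a square, so its nonnegativity requires no
    separate argument about \<open>varphi (x j)\<close> or \<open>w j\<close>.\<close>
  moreover have "?\<nu> * h (n + 1) \<noteq> 0"
    using ode_eigenvalue_nonzero[of "2 * n + 2"] h_pos[of "n + 1"] by simp
  ultimately have "k\<^sup>2 * (2 * real n + 2) * poly varphi (x j) * w j / (?\<nu> * h (n + 1))
      = (barycentric_weight n x j)\<^sup>2"
    by (simp del: mult_eq_0_iff)
  then have "sqrt (k\<^sup>2 * (2 * real n + 2) * poly varphi (x j) * w j / (?\<nu> * h (n + 1)))
      = \<bar>barycentric_weight n x j\<bar>"
    by simp
  \<comment> \<open>The prefactor is \<open>(-1) ^ (n + j)\<close>, which has the parity of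
    \<open>n - j\<close> since \<open>j \<le> n\<close>.\<close>
  moreover have "(if even n then 1 else - 1) * (- 1) ^ j = sgn (barycentric_weight n x j)"
    using sgn_barycentric_weight[OF assms(10) j] j
    by (auto simp: minus_one_power_iff)
  ultimately show "barycentric_weight n x j =
           (if even n then 1 else - 1) * (- 1) ^ j *
           sqrt ((lead_coeff (\<pi> (n + 1)))\<^sup>2 * (2 * real n + 2) * poly varphi (x j) * w j
                 / (?\<nu> * h (n + 1)))"
    unfolding k_def by (simp only: sgn_mult_abs)
qed

end
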